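(* Let $x,y,z\in(0,1)$ be such that $z^2=x^2+y^2$. If $p\geq1$, then $$1+\frac{\arcsin_p(z^2)}{z^2}\geq\frac{\arcsin_p(x^2)}{x^2}+\frac{\arcsin_p(y^2)}{y^2},$$ $$1+\frac{\operatorname{arctanh}_p(z^2)}{z^2}\geq\frac{\operatorname{arctanh}_p(x^2)}{x^2}+\frac{\operatorname{arctanh}_p(y^2)}{y^2}.$$ Moreover, if $p\geq 2$, then $$1+\frac{\arctan_p(z^2)}{z^2}\leq\frac{\arctan_p(x^2)}{x^2}+\frac{\arctan_p(y^2)}{y^2},$$ $$1+\frac{\operatorname{arcsinh}_p(z^2)}{z^2}\leq\frac{\operatorname{arcsinh}_p(x^2)}{x^2}+\frac{\operatorname{arcsinh}_p(y^2)}{y^2},$$ and the last inequality (the one for $\operatorname{arcsinh}_p$) is reversed when $p\in(0,1]$.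
   Context: For real $p>0$ and $x\in(0,1)$, define $$\arcsin_p(x)=\int_0^x(1-t^p)^{-1/p}\,dt,\quad \arctan_p(x)=\int_0^x(1+t^p)^{-1}\,dt,$$ $$\operatorname{arcsinh}_p(x)=\int_0^x(1+t^p)^{-1/p}\,dt,\quad \operatorname{arctanh}_p(x)=\int_0^x(1-t^p)^{-1}\,dt.$$ *)

theory Defs
  imports "HOL-Analysis.Analysis"
begin

text \<open>The four functions are meant for parameters \<open>p > 0\<close> and arguments \<open>0 < x < 1\<close>; there all
  bases of \<open>powr\<close> below are nonnegative and the integrands are continuous on \<open>{0..x}\<close>
  (in particular \<open>0 powr p = 0\<close> is the correct value at the left endpoint).\<close>

definition arcsin_p :: "real \<Rightarrow> real \<Rightarrow> real" where
  "arcsin_p p x = integral {0..x} (\<lambda>t. (1 - t powr p) powr (- 1 / p))"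

definition arctan_p :: "real \<Rightarrow> real \<Rightarrow> real" where
  "arctan_p p x = integral {0..x} (\<lambda>t. inverse (1 + t powr p))"

definition arcsinh_p :: "real \<Rightarrow> real \<Rightarrow> real" where
  "arcsinh_p p x = integral {0..x} (\<lambda>t. (1 + t powr p) powr (- 1 / p))"

definition arctanh_p :: "real \<Rightarrow> real \<Rightarrow> real" where
  "arctanh_p p x = integral {0..x} (\<lambda>t. inverse (1 - t powr p))"

end

theory Submission
  imports Defs
begin

text \<open>
  Write \<open>a = x\<^sup>2\<close>, \<open>b = y\<^sup>2\<close>, so that \<open>z\<^sup>2 = a + b < 1\<close>.  All four integrands belong to the
  family \<open>g t = (1 + s t\<^sup>p)\<^sup>-\<^sup>q\<close> with \<open>s = 1\<close> or \<open>s = -1\<close>, and \<open>q = 1/p\<close> or \<open>q = 1\<close>.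
  Rescaling gives \<open>(1/a) \<integral>\<^sub>0\<^sup>a g = \<integral>\<^sub>0\<^sup>1 g (a r) dr\<close>, so each inequality is the average over
  \<open>r\<close> of the pointwise inequality \<open>1 + g (u + v) \<ge> g u + g v\<close> (or \<open>\<le>\<close>) at \<open>u = a r\<close>,
  \<open>v = b r\<close>: superadditivity (or subadditivity) of \<open>g - 1\<close>.

  A function \<open>h\<close> with \<open>h 0 = 0\<close> is superadditive as soon as \<open>h t / t\<close> is increasing.
  For \<open>h = g - 1\<close> and \<open>w = t\<^sup>p\<close> the derivative of \<open>h t / t\<close> has the sign of
  \<open>(1 + s w)\<^sup>q\<^sup>+\<^sup>1 - 1 - (1 + p q) s w\<close>, so everything reduces to the sign of this expression
  for \<open>0 < w < 1\<close>.  When \<open>q = 1/p\<close> it compares \<open>(1 + s w)\<close> raised to \<open>1 + 1/p\<close> with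
  \<open>1 + 2 s w\<close>; when \<open>q = 1\<close> it is a quadratic polynomial in \<open>w\<close>.  Convexity of \<open>h\<close> would be too
  strong a demand: for \<open>s = 1\<close> and \<open>p = 2\<close> the function \<open>1 - g\<close> is not convex on \<open>(0, 1)\<close>,
  although \<open>(1 - g t) / t\<close> is increasing there.
\<close>

lemma superadditive_if_ratio_mono:
  fixes h :: "real \<Rightarrow> real"
  assumes mono: "\<And>u v. 0 < u \<Longrightarrow> u \<le> v \<Longrightarrow> v < c \<Longrightarrow> h u / u \<le> h v / v"
    and h0: "h 0 = 0" and u: "0 \<le> u" and v: "0 \<le> v" and uv: "u + v < c"
  shows "h u + h v \<le> h (u + v)"
proof (cases "u = 0 \<or> v = 0")
  case True
  then show ?thesis using h0 by auto
next
  case False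
  then have pos: "u > 0" "v > 0" using u v by auto
  have "h u \<le> u * (h (u + v) / (u + v))"
    using mono[of u "u + v"] pos uv by (simp add: field_simps)
  moreover have "h v \<le> v * (h (u + v) / (u + v))"
    using mono[of v "u + v"] pos uv by (simp add: field_simps)
  moreover have "u * (h (u + v) / (u + v)) + v * (h (u + v) / (u + v)) = h (u + v)"
    using pos by (simp only: distrib_right[symmetric]) simp
  ultimately show ?thesis by linarith
qed

lemma one_plus_powr_pos:
  fixes s t p :: real
  assumes "\<bar>s\<bar> \<le> 1" "0 \<le> t" "t < 1" "0 < p"
  shows "0 < 1 + s * t powr p"
proof -
  have "t powr p < 1" using powr_less_mono2[of p t 1] assms by simp
  moreover have "\<bar>s * t powr p\<bar> \<le> 1 * t powr p"
    unfolding abs_mult using assms by (intro mult_mono) auto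
  ultimately show ?thesis by linarith
qed

text \<open>
  The derivative of \<open>(g t - 1) / t\<close>, with \<open>g t = (1 + s t\<^sup>p)\<^sup>-\<^sup>q\<close>, is
  \<open>(1 + s t\<^sup>p)\<^sup>-\<^sup>q\<^sup>-\<^sup>1 / t\<^sup>2\<close> times the expression in the hypothesis.  The factor \<open>\<sigma>\<close> is a sign:
  \<open>\<sigma> = 1\<close> gives an increasing and \<open>\<sigma> = -1\<close> a decreasing ratio.
\<close>

lemma ratio_mono:
  fixes s p q \<sigma> u v :: real
  assumes s: "\<bar>s\<bar> \<le> 1" and p: "0 < p"
    and sign: "\<And>w. 0 < w \<Longrightarrow> w < 1 \<Longrightarrow>
      0 \<le> \<sigma> * ((1 + s * w) powr (q + 1) - 1 - (1 + p * q) * (s * w))"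
    and u: "0 < u" and uv: "u \<le> v" and v: "v < 1"
  shows "\<sigma> * ((1 + s * u powr p) powr (-q) - 1) / u \<le> \<sigma> * ((1 + s * v powr p) powr (-q) - 1) / v"
proof (rule DERIV_nonneg_imp_nondecreasing[OF uv])
  fix t assume "u \<le> t" "t \<le> v"
  then have t: "0 < t" "t < 1" using u v by auto
  define w where "w = t powr p"
  define B where "B = 1 + s * w"
  have w: "0 < w" "w < 1" using t p powr_less_mono2[of p t 1] by (auto simp: w_def)
  have B: "0 < B" unfolding B_def w_def using one_plus_powr_pos[OF s _ t(2) p] t by simp
  let ?D = "\<sigma> * (B powr (-q-1) * (B powr (q + 1) - 1 - (1 + p * q) * (s * w)) / t\<^sup>2)"
  have tp: "t powr (p - 1) * t = w"
    using t by (simp add: w_def powr_diff)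
  have b1: "B powr (-q-1) * B powr (q + 1) = 1"
    using B by (simp add: powr_add[symmetric])
  have b2: "B powr (-q) = B powr (-q-1) * B"
    using B by (simp add: powr_diff)
  \<comment> \<open>the quotient rule, with \<open>B\<^sup>-\<^sup>q\<close> written as \<open>B\<^sup>-\<^sup>q\<^sup>-\<^sup>1 B\<close> and \<open>1\<close> as \<open>B\<^sup>-\<^sup>q\<^sup>-\<^sup>1 B\<^sup>q\<^sup>+\<^sup>1\<close>\<close>
  have num: "(-q) * B powr (-q-1) * (s * (p * t powr (p - 1))) * t - (B powr (-q) - 1)
      = B powr (-q-1) * (B powr (q + 1) - 1 - (1 + p * q) * (s * w))"
  proof -
    have "(-q) * B powr (-q-1) * (s * (p * t powr (p - 1))) * t
        = (-q) * B powr (-q-1) * (s * p * w)"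
      unfolding tp[symmetric] by (simp only: mult_ac)
    moreover have "B powr (-q-1) * (B powr (q + 1) - 1 - (1 + p * q) * (s * w))
        = 1 - B powr (-q-1) * (1 + (1 + p * q) * (s * w))"
      using b1 by (simp add: algebra_simps)
    moreover have "(-q) * B powr (-q-1) * (s * p * w) - (B powr (-q-1) * B - 1)
        = 1 - B powr (-q-1) * (1 + (1 + p * q) * (s * w))"
      by (simp add: B_def algebra_simps)
    ultimately show ?thesis unfolding b2 by argo
  qed
  have inner: "((\<lambda>t. 1 + s * t powr p) has_real_derivative s * (p * t powr (p - 1))) (at t)"
    using t by (auto intro!: derivative_eq_intros)
  have g: "((\<lambda>t. (1 + s * t powr p) powr (-q)) has_real_derivative
      (-q) * B powr (-q-1) * (s * (p * t powr (p - 1)))) (at t)"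
    using DERIV_fun_powr[OF inner, of "-q"] B by (simp add: B_def w_def)
  have "((\<lambda>t. ((1 + s * t powr p) powr (-q) - 1) / t) has_real_derivative
      ((-q) * B powr (-q-1) * (s * (p * t powr (p - 1))) * t - (B powr (-q) - 1)) / t\<^sup>2) (at t)"
    using DERIV_quotient[OF DERIV_diff[OF g DERIV_const[of 1]] DERIV_ident] t
    unfolding B_def w_def by (simp add: mult.commute numeral_2_eq_2)
  from DERIV_cmult[OF this[unfolded num], of \<sigma>]
  have "((\<lambda>t. \<sigma> * ((1 + s * t powr p) powr (-q) - 1) / t) has_real_derivative ?D) (at t)"
    by (simp only: times_divide_eq_right)
  moreover have "0 \<le> ?D"
  proof -
    have "?D = (B powr (-q-1) / t\<^sup>2) * (\<sigma> * (B powr (q + 1) - 1 - (1 + p * q) * (s * w)))"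
      by simp
    then show ?thesis using sign[OF w] B_def by (simp del: times_divide_eq_left)
  qed
  ultimately show "\<exists>D. ((\<lambda>t. \<sigma> * ((1 + s * t powr p) powr (-q) - 1) / t)
      has_real_derivative D) (at t) \<and> 0 \<le> D" by blast
qed

lemma integral_rescale:
  fixes g :: "real \<Rightarrow> real"
  assumes "continuous_on {0..a} g" "0 < a"
  shows "((\<lambda>r. g (a * r)) has_integral integral {0..a} g / a) {0..1}"
proof -
  have "(g has_integral integral {0..a} g) {0..a}"
    using assms integrable_continuous_real integrable_integral by blast
  from has_integral_stretch_real[OF this, of a] assms(2) show ?thesis
    by (simp add: image_divide_atLeastAtMost divide_inverse_commute)
qed

text \<open>
  The common form of all five inequalities: the pointwise superadditivity of \<open>\<sigma> (g - 1)\<close>,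
  averaged along the segment from \<open>0\<close> to \<open>(a, b)\<close>.
\<close>

lemma average_superadditive:
  fixes s p q \<sigma> a b :: real
  defines "F \<equiv> \<lambda>a. integral {0..a} (\<lambda>t. (1 + s * t powr p) powr (-q)) / a"
  assumes s: "\<bar>s\<bar> \<le> 1" and p: "0 < p"
    and sign: "\<And>w. 0 < w \<Longrightarrow> w < 1 \<Longrightarrow>
      0 \<le> \<sigma> * ((1 + s * w) powr (q + 1) - 1 - (1 + p * q) * (s * w))"
    and a: "0 < a" and b: "0 < b" and ab: "a + b < 1"
  shows "\<sigma> * (F a + F b) \<le> \<sigma> * (1 + F (a + b))"
proof -
  define g where "g t = (1 + s * t powr p) powr (-q)" for t
  have F: "((\<lambda>r. g (c * r)) has_integral F c) {0..1}" if c: "0 < c" "c < 1" for c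
  proof -
    have "continuous_on {0..c} g"
      unfolding g_def using c p one_plus_powr_pos[OF s _ _ p]
      by (intro continuous_intros continuous_on_powr') (force simp: less_le)+
    from integral_rescale[OF this c(1)] show ?thesis by (simp add: F_def g_def[abs_def])
  qed
  have super: "\<sigma> * (g u - 1) + \<sigma> * (g v - 1) \<le> \<sigma> * (g (u + v) - 1)"
    if "0 \<le> u" "0 \<le> v" "u + v < 1" for u v
    using superadditive_if_ratio_mono[of 1 "\<lambda>t. \<sigma> * (g t - 1)" u v] ratio_mono[OF s p sign] that p
    by (simp add: g_def)
  have "((\<lambda>r. \<sigma> * (g (a * r) + g (b * r))) has_integral \<sigma> * (F a + F b)) {0..1}"
    using F[of a] F[of b] a b ab by (intro has_integral_mult_right has_integral_add) auto
  moreover have "((\<lambda>r. \<sigma> * (1 + g ((a + b) * r))) has_integral \<sigma> * (1 + F (a + b))) {0..1}"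
    using F[of "a + b"] has_integral_const_real[of "1::real" 0 1] a b ab
    by (intro has_integral_mult_right has_integral_add) auto
  moreover have "\<sigma> * (g (a * r) + g (b * r)) \<le> \<sigma> * (1 + g ((a + b) * r))"
    if r: "r \<in> {0..1}" for r
  proof -
    have "(a + b) * r \<le> (a + b) * 1" using r a b by (intro mult_left_mono) auto
    then have "a * r + b * r < 1" using ab by (simp add: distrib_right)
    then have "\<sigma> * (g (a * r) - 1) + \<sigma> * (g (b * r) - 1) \<le> \<sigma> * (g (a * r + b * r) - 1)"
      using super[of "a * r" "b * r"] r a b by simp
    then show ?thesis by (simp add: algebra_simps)
  qed
  ultimately show ?thesis by (rule has_integral_le)
qed

lemma inverse_eq_powr_neg_one: "0 < (a :: real) \<Longrightarrow> inverse a = a powr - 1"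
  by (simp add: powr_minus)

lemma arctan_p_eq:
  "arctan_p p a = integral {0..a} (\<lambda>t. (1 + 1 * t powr p) powr - 1)"
  unfolding arctan_p_def by (simp add: inverse_eq_powr_neg_one add_pos_nonneg)

lemma arctanh_p_eq:
  assumes "0 < p" "a < 1"
  shows "arctanh_p p a = integral {0..a} (\<lambda>t. (1 + (-1) * t powr p) powr - 1)"
  unfolding arctanh_p_def
proof (rule integral_cong)
  fix t assume "t \<in> {0..a}"
  then have "0 < 1 + (-1) * t powr p"
    using assms by (intro one_plus_powr_pos) auto
  then show "inverse (1 - t powr p) = (1 + (-1) * t powr p) powr - 1"
    by (simp add: inverse_eq_powr_neg_one)
qed

text \<open>The exponent \<open>1 + 1/p\<close> is at most \<open>2\<close>, and the base lies in \<open>(0, 1)\<close>, so the square is a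
  lower bound.\<close>

lemma powr_ge_one_minus_double:
  fixes p w :: real
  assumes "1 \<le> p" "0 < w" "w < 1"
  shows "1 - 2 * w \<le> (1 - w) powr (1 / p + 1)"
proof -
  have "1 - 2 * w \<le> (1 - w)\<^sup>2" by (simp add: power2_diff)
  also have "\<dots> = (1 - w) powr 2" using assms by simp
  also have "\<dots> \<le> (1 - w) powr (1 / p + 1)" using assms by (intro powr_mono') auto
  finally show ?thesis .
qed

text \<open>The exponent \<open>1 + 1/p\<close> is at most \<open>3/2\<close>, and \<open>(1 + w)\<^sup>3 \<le> (1 + 2 w)\<^sup>2\<close> because
  \<open>w\<^sup>3 \<le> w + w\<^sup>2\<close> on the unit interval.\<close>

lemma powr_le_one_plus_double:
  fixes p w :: real
  assumes "2 \<le> p" "0 < w" "w < 1"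
  shows "(1 + w) powr (1 / p + 1) \<le> 1 + 2 * w"
proof -
  have "w ^ 3 \<le> w ^ 1" using assms by (intro power_decreasing) auto
  then have "w ^ 3 \<le> w + w\<^sup>2" using zero_le_power2[of w] unfolding power_one_right by linarith
  then have "(1 + w) ^ 3 \<le> (1 + 2 * w)\<^sup>2"
    by (simp add: power2_eq_square power3_eq_cube algebra_simps)
  moreover have "((1 + w) powr (3 / 2))\<^sup>2 = (1 + w) ^ 3"
    using assms by (simp add: powr_power)
  ultimately have "((1 + w) powr (3 / 2))\<^sup>2 \<le> (1 + 2 * w)\<^sup>2" by (simp only:)
  then have "(1 + w) powr (3 / 2) \<le> 1 + 2 * w"
    by (rule power2_le_imp_le) (use assms in simp)
  moreover have "(1 + w) powr (1 / p + 1) \<le> (1 + w) powr (3 / 2)"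
    by (rule powr_mono) (use assms in \<open>simp_all add: divide_simps\<close>)
  ultimately show ?thesis by linarith
qed

text \<open>The exponent \<open>1 + 1/p\<close> is at least \<open>2\<close>, and the base exceeds \<open>1\<close>.\<close>

lemma powr_ge_one_plus_double:
  fixes p w :: real
  assumes "0 < p" "p \<le> 1" "0 < w"
  shows "1 + 2 * w \<le> (1 + w) powr (1 / p + 1)"
proof -
  have "1 + 2 * w \<le> (1 + w)\<^sup>2" by (simp add: power2_sum)
  also have "\<dots> = (1 + w) powr 2" using assms by simp
  also have "\<dots> \<le> (1 + w) powr (1 / p + 1)"
    using assms by (intro powr_mono) (auto simp: field_simps)
  finally show ?thesis .
qed

theorem theorem5:
  fixes x y z p :: real
  assumes "x \<in> {0<..<1}" and "y \<in> {0<..<1}" and "z \<in> {0<..<1}"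
    and "z\<^sup>2 = x\<^sup>2 + y\<^sup>2"
  shows "(p \<ge> 1 \<longrightarrow>
            1 + arcsin_p p (z\<^sup>2) / z\<^sup>2 \<ge> arcsin_p p (x\<^sup>2) / x\<^sup>2 + arcsin_p p (y\<^sup>2) / y\<^sup>2 \<and>
            1 + arctanh_p p (z\<^sup>2) / z\<^sup>2 \<ge> arctanh_p p (x\<^sup>2) / x\<^sup>2 + arctanh_p p (y\<^sup>2) / y\<^sup>2) \<and>
         (p \<ge> 2 \<longrightarrow>
            1 + arctan_p p (z\<^sup>2) / z\<^sup>2 \<le> arctan_p p (x\<^sup>2) / x\<^sup>2 + arctan_p p (y\<^sup>2) / y\<^sup>2 \<and>
            1 + arcsinh_p p (z\<^sup>2) / z\<^sup>2 \<le> arcsinh_p p (x\<^sup>2) / x\<^sup>2 + arcsinh_p p (y\<^sup>2) / y\<^sup>2) \<and>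
         (p \<in> {0<..1} \<longrightarrow>
            1 + arcsinh_p p (z\<^sup>2) / z\<^sup>2 \<ge> arcsinh_p p (x\<^sup>2) / x\<^sup>2 + arcsinh_p p (y\<^sup>2) / y\<^sup>2)"
proof -
  define a b where "a = x\<^sup>2" and "b = y\<^sup>2"
  have a: "0 < a" and b: "0 < b" using assms by (auto simp: a_def b_def)
  have c: "z\<^sup>2 = a + b" using assms by (simp add: a_def b_def)
  have ab: "a + b < 1" using assms(3) c power_strict_mono[of z 1 2] by simp
  note average = average_superadditive[OF _ _ _ a b ab]
  have "arcsin_p p a / a + arcsin_p p b / b \<le> 1 + arcsin_p p (a + b) / (a + b)" if "1 \<le> p"
  proof -
    have "0 \<le> (1 - w) powr (1 / p + 1) - 1 + 2 * w" if "0 < w" "w < 1" for w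
      using powr_ge_one_minus_double[OF \<open>1 \<le> p\<close> that] by simp
    then show ?thesis
      using average[of "-1" p 1 "1 / p"] that by (simp add: arcsin_p_def)
  qed
  moreover have "arctanh_p p a / a + arctanh_p p b / b \<le> 1 + arctanh_p p (a + b) / (a + b)"
    if p: "1 \<le> p"
  proof -
    have "0 \<le> (1 - w) powr 2 - 1 + (1 + p) * w" if w: "0 < w" "w < 1" for w
    proof -
      have "1 * w \<le> p * w" using w p by (intro mult_right_mono) auto
      then have "1 - (1 + p) * w \<le> (1 - w)\<^sup>2"
        using zero_le_power2[of w] unfolding power2_diff distrib_right one_power2 by linarith
      then show ?thesis using w by simp
    qed
    then show ?thesis
      using average[of "-1" p 1 1] p a b ab by (simp add: arctanh_p_eq)
  qed
  moreover have "1 + arctan_p p (a + b) / (a + b) \<le> arctan_p p a / a + arctan_p p b / b"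
    if p: "2 \<le> p"
  proof -
    have "(1 + w) powr 2 - 1 \<le> (1 + p) * w" if w: "0 < w" "w < 1" for w
    proof -
      have "w * w \<le> 1 * w" using w by (intro mult_right_mono) auto
      moreover have "2 * w \<le> p * w" using w p by (intro mult_right_mono) auto
      ultimately have "(1 + w)\<^sup>2 \<le> 1 + (1 + p) * w"
        by (simp add: power2_eq_square algebra_simps)
      then show ?thesis using w by simp
    qed
    then show ?thesis
      using average[of 1 p "-1" 1] p by (simp add: arctan_p_eq)
  qed
  moreover have "1 + arcsinh_p p (a + b) / (a + b) \<le> arcsinh_p p a / a + arcsinh_p p b / b"
    if "2 \<le> p"
  proof -
    have "(1 + w) powr (1 / p + 1) - 1 \<le> 2 * w" if "0 < w" "w < 1" for w
      using powr_le_one_plus_double[OF \<open>2 \<le> p\<close> that] by simp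
    then show ?thesis
      using average[of 1 p "-1" "1 / p"] that by (simp add: arcsinh_p_def)
  qed
  moreover have "arcsinh_p p a / a + arcsinh_p p b / b \<le> 1 + arcsinh_p p (a + b) / (a + b)"
    if p: "0 < p" "p \<le> 1"
  proof -
    have "2 * w \<le> (1 + w) powr (1 / p + 1) - 1" if "0 < w" "w < 1" for w
      using powr_ge_one_plus_double[OF p that(1)] by simp
    then show ?thesis
      using average[of 1 p 1 "1 / p"] p by (simp add: arcsinh_p_def)
  qed
  ultimately show ?thesis
    unfolding c a_def[symmetric] b_def[symmetric] by auto
qed

end
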